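(* Let $\mathcal{Z}_N=\{Z^{(1)},\dots,Z^{(N)}\}\subset\mathcal{Z}$ be a given dataset and $\mathbb{P}_N=\sum_{i=1}^N\mu_i\boldsymbol{\chi}_{\{Z^{(i)}\}}\in\mathcal{P}(\mathcal{Z})$ the corresponding empirical distribution, where $\mu_i\ge 0$ and $\sum_{i=1}^N\mu_i=1$. Let $d(\cdot,\cdot)$ be a cost function on $\mathcal{Z}\times\mathcal{Z}$ and $\delta\in(0,\infty)$. Let $\mathcal{B}$ be a set, suppose the loss function $\ell:\mathcal{Z}\times\mathcal{B}\to\mathbb{R}$ has the form $\ell(z;\beta)=\psi_\beta(z)$, and fix $\beta\in\mathcal{B}$ such that $\psi_\beta:\mathcal{Z}\to\mathbb{R}$ satisfies: (A1) $\psi_\beta$ is $(L_\beta^{\mathcal{Z}_N},d)$-Lipschitz at $\mathcal{Z}_N$ with $L_\beta^{\mathcal{Z}_N}\in(0,\infty)$; (A2) for any $\epsilon\in(0,L_\beta^{\mathcal{Z}_N})$ and each $Z^{(i)}\in\mathcal{Z}_N$, there exists $\tilde Z^{(i)}_\epsilon\in\mathcal{Z}$ such that $\delta\le d(\tilde Z^{(i)}_\epsilon,Z^{(i)})<\infty$ and $$\psi_\beta(\tilde Z^{(i)}_\epsilon)-\psi_\beta(Z^{(i)})\ge(L_\beta^{\mathcal{Z}_N}-\epsilon)\,d(\tilde Z^{(i)}_\epsilon,Z^{(i)}).$$ Then $$\sum_{i=1}^N\mu_i\,\sup_{\mathbb{P}\in\mathcal{P}(\mathcal{Z}):\ \mathcal{W}_{d,1}(\mathbb{P},\boldsymbol{\chi}_{\{Z^{(i)}\}})\le\delta}\mathrm{E}_{\mathbb{P}}[\ell(Z;\beta)]\;=\;\sup_{\mathbb{P}\in\mathcal{P}(\mathcal{Z}):\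 \mathcal{W}_{d,1}(\mathbb{P},\mathbb{P}_N)\le\delta}\mathrm{E}_{\mathbb{P}}[\ell(Z;\beta)]\;=\;\mathrm{E}_{\mathbb{P}_N}[\ell(Z;\beta)]+L_\beta^{\mathcal{Z}_N}\delta.$$
   Context: $\mathcal{Z}$ is a measurable space in which every singleton $\{z\}$ is measurable; $\mathcal{Z}\times\mathcal{Z}$ carries the product $\sigma$-algebra; $\mathcal{P}(\mathcal{Z})$ is the set of probability measures on $\mathcal{Z}$; $\boldsymbol{\chi}_{\{\hat z\}}$ is the Dirac measure at $\hat z$; $\mathrm{E}_{\mathbb{P}}[f(Z)]=\int_{\mathcal{Z}}f\,\mathrm{d}\mathbb{P}$. Standing assumption: $\ell(\cdot;\beta)$ is measurable for every $\beta\in\mathcal{B}$. Convention: $0\cdot\infty=0$. Cost function: a measurable function $d:\mathcal{Z}\times\mathcal{Z}\to[0,\infty]$ with $d(z,z)=0$ for all $z\in\mathcal{Z}$ (no symmetry, triangle inequality or positive definiteness required). Wasserstein discrepancy: for $\mathbb{P},\mathbb{Q}\in\mathcal{P}(\mathcal{Z})$, $\mathcal{W}_{d,1}(\mathbb{P},\mathbb{Q})=\inf_{\pi\in\Pi(\mathbb{P},\mathbb{Q})}\int_{\mathcal{Z}\times\mathcal{Z}}d(z',z)\,\mathrm{d}\pi(z',z)$, where $\Pi(\mathbb{P},\mathbb{Q})$ is the set of probability measures $\pi$ on $\mathcal{Z}\times\mathcal{Z}$ with first marginal $\mathbb{P}$ and second marginal $\mathbb{Q}$. Weak Lipschitz property: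 for $f:\mathcal{Z}\to\mathbb{R}$, $S\subset\mathcal{Z}$ and a constant $L\in[0,\infty)$, $f$ is called $(L,d)$-Lipschitz at $S$ if $|f(z')-f(z)|\le L\,d(z',z)$ for all $z\in S$ and $z'\in\mathcal{Z}$. *)

theory Defs
  imports "HOL-Probability.Probability"
begin

text \<open>
  The measurable space \<open>\<Z>\<close> is given by a measure \<open>M\<close>, of which only \<open>space M\<close> and \<open>sets M\<close>
  matter; the set of probability measures on it is \<open>space (prob_algebra M)\<close>, and the Dirac measure
  at \<open>z\<close> is \<open>return M z\<close>.
\<close>

definition cost_function :: "'z measure \<Rightarrow> ('z \<Rightarrow> 'z \<Rightarrow> ennreal) \<Rightarrow> bool" where
  "cost_function M d \<longleftrightarrow>
     (\<lambda>(z', z). d z' z) \<in> borel_measurable (M \<Otimes>\<^sub>M M) \<and> (\<forall>z\<in>space M. d z z = 0)"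

definition couplings :: "'z measure \<Rightarrow> 'z measure \<Rightarrow> 'z measure \<Rightarrow> ('z \<times> 'z) measure set" where
  "couplings M P Q =
     {\<pi> \<in> space (prob_algebra (M \<Otimes>\<^sub>M M)). distr \<pi> M fst = P \<and> distr \<pi> M snd = Q}"

definition wasserstein ::
    "'z measure \<Rightarrow> ('z \<Rightarrow> 'z \<Rightarrow> ennreal) \<Rightarrow> 'z measure \<Rightarrow> 'z measure \<Rightarrow> ennreal" where
  "wasserstein M d P Q = (INF \<pi>\<in>couplings M P Q. \<integral>\<^sup>+ (z', z). d z' z \<partial>\<pi>)"

definition wasserstein_ball ::
    "'z measure \<Rightarrow> ('z \<Rightarrow> 'z \<Rightarrow> ennreal) \<Rightarrow> 'z measure \<Rightarrow> real \<Rightarrow> 'z measure set" where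
  "wasserstein_ball M d Q \<delta> =
     {P \<in> space (prob_algebra M). wasserstein M d P Q \<le> ennreal \<delta>}"

text \<open>
  The inequality is stated in \<^typ>\<open>ennreal\<close> because \<open>d z' z\<close> may be infinite; there \<open>0 * \<infinity> = 0\<close>.
\<close>

definition weak_lipschitz_at ::
    "'z measure \<Rightarrow> ('z \<Rightarrow> 'z \<Rightarrow> ennreal) \<Rightarrow> real \<Rightarrow> 'z set \<Rightarrow> ('z \<Rightarrow> real) \<Rightarrow> bool" where
  "weak_lipschitz_at M d L S f \<longleftrightarrow>
     0 \<le> L \<and> (\<forall>z\<in>S. \<forall>z'\<in>space M. ennreal \<bar>f z' - f z\<bar> \<le> ennreal L * d z' z)"

definition empirical ::
    "'z measure \<Rightarrow> nat \<Rightarrow> (nat \<Rightarrow> real) \<Rightarrow> (nat \<Rightarrow> 'z) \<Rightarrow> 'z measure" where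
  "empirical M N \<mu> Z =
     measure_of (space M) (sets M) (\<lambda>A. \<Sum>i=1..N. ennreal (\<mu> i) * emeasure (return M (Z i)) A)"

lemma space_empirical [simp]: "space (empirical M N \<mu> Z) = space M"
  and sets_empirical [simp, measurable_cong]: "sets (empirical M N \<mu> Z) = sets M"
  by (simp_all add: empirical_def)

lemma emeasure_empirical:
  assumes "A \<in> sets M"
  shows "emeasure (empirical M N \<mu> Z) A = (\<Sum>i=1..N. ennreal (\<mu> i) * emeasure (return M (Z i)) A)"
  unfolding empirical_def
proof (rule emeasure_measure_of_sigma)
  let ?m = "\<lambda>A. \<Sum>i=1..N. ennreal (\<mu> i) * emeasure (return M (Z i)) A"
  show "sigma_algebra (space M) (sets M)" by (rule sets.sigma_algebra_axioms)
  show "positive (sets M) ?m" by (simp add: positive_def)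
  show "countably_additive (sets M) ?m"
  proof (rule countably_additiveI)
    fix B :: "nat \<Rightarrow> _" assume B: "range B \<subseteq> sets M" "disjoint_family B"
    have "(\<Sum>n. emeasure (return M (Z i)) (B n)) = emeasure (return M (Z i)) (\<Union>n. B n)" for i
      using B by (intro suminf_emeasure) auto
    then show "(\<Sum>n. ?m (B n)) = ?m (\<Union>n. B n)"
      by (subst suminf_sum) auto
  qed
qed (use assms in auto)

lemma empirical_in_prob_algebra:
  assumes "\<And>i. i \<in> {1..N} \<Longrightarrow> Z i \<in> space M" "\<And>i. i \<in> {1..N} \<Longrightarrow> 0 \<le> \<mu> i"
    and "(\<Sum>i=1..N. \<mu> i) = 1"
  shows "empirical M N \<mu> Z \<in> space (prob_algebra M)"
proof -
  have "emeasure (empirical M N \<mu> Z) (space M) = (\<Sum>i=1..N. ennreal (\<mu> i))"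
    unfolding emeasure_empirical[OF sets.top]
    by (rule sum.cong) (use assms(1) in auto)
  also have "\<dots> = ennreal (\<Sum>i=1..N. \<mu> i)" using assms(2) by (rule sum_ennreal)
  also have "\<dots> = 1" unfolding assms(3) by simp
  finally show ?thesis
    by (auto simp: space_prob_algebra intro!: prob_spaceI)
qed

text \<open>
  The Bochner integral is \<open>0\<close> on non-integrable functions. This never matters inside a Wasserstein
  ball around a finitely supported measure: every function that is weakly Lipschitz at the support
  is integrable there.
\<close>

lemma integrable_wasserstein_ball:
  assumes d: "cost_function M d" and f: "f \<in> borel_measurable M"
    and S: "finite S" "S \<in> sets M" and lip: "weak_lipschitz_at M d L S f"
    and supp: "AE z in Q. z \<in> S" and P: "P \<in> wasserstein_ball M d Q \<delta>"
  shows "integrable P f"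
proof -
  have "wasserstein M d P Q < \<infinity>"
    using P by (auto simp: wasserstein_ball_def intro: le_less_trans)
  then obtain \<pi> where \<pi>: "\<pi> \<in> couplings M P Q" and fin: "(\<integral>\<^sup>+ (z', z). d z' z \<partial>\<pi>) < \<infinity>"
    unfolding wasserstein_def by (auto simp: INF_less_iff)
  from \<pi> have prob: "prob_space \<pi>" and sets_\<pi>: "sets \<pi> = sets (M \<Otimes>\<^sub>M M)"
    and P_eq: "P = distr \<pi> M fst" and Q_eq: "Q = distr \<pi> M snd"
    by (auto simp: couplings_def space_prob_algebra)
  note [measurable_cong] = sets_\<pi>
  note [measurable] = f S(2)
  interpret prob_space \<pi> by (rule prob)
  have [measurable]: "(\<lambda>(z', z). d z' z) \<in> borel_measurable \<pi>"
    using d sets_\<pi> by (simp add: cost_function_def cong: measurable_cong_sets)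
  have L: "0 \<le> L" using lip by (simp add: weak_lipschitz_at_def)
  define C where "C = (\<Sum>z\<in>S. \<bar>f z\<bar>)"
  have C: "0 \<le> C" by (simp add: C_def sum_nonneg)
  have AE_S: "AE p in \<pi>. snd p \<in> S"
    using supp unfolding Q_eq by (subst (asm) AE_distr_iff) auto
  have bound: "ennreal (norm (f (fst p))) \<le> ennreal C + ennreal L * (case p of (z', z) \<Rightarrow> d z' z)"
    if p: "p \<in> space \<pi>" "snd p \<in> S" for p
  proof -
    have "fst p \<in> space M"
      using p(1) unfolding sets_eq_imp_space_eq[OF sets_\<pi>] space_pair_measure mem_Times_iff
      by (rule conjunct1)
    then have *: "ennreal \<bar>f (fst p) - f (snd p)\<bar> \<le> ennreal L * d (fst p) (snd p)"
      using lip p(2) unfolding weak_lipschitz_at_def by blast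
    have "\<bar>f (snd p)\<bar> \<le> C"
      unfolding C_def using p(2) S(1) by (intro member_le_sum) simp_all
    then have "norm (f (fst p)) \<le> C + \<bar>f (fst p) - f (snd p)\<bar>"
      unfolding real_norm_def by linarith
    then have "ennreal (norm (f (fst p))) \<le> ennreal (C + \<bar>f (fst p) - f (snd p)\<bar>)"
      by (rule ennreal_leI)
    also have "\<dots> = ennreal C + ennreal \<bar>f (fst p) - f (snd p)\<bar>"
      using C by (rule ennreal_plus) (rule abs_ge_zero)
    also have "\<dots> \<le> ennreal C + ennreal L * d (fst p) (snd p)"
      using * by (rule add_left_mono)
    finally show ?thesis
      by (simp only: case_prod_beta)
  qed
  have "AE p in \<pi>. ennreal (norm (f (fst p))) \<le> ennreal C + ennreal L * (case p of (z', z) \<Rightarrow> d z' z)"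
    using AE_space AE_S by eventually_elim (rule bound)
  then have "(\<integral>\<^sup>+ p. ennreal (norm (f (fst p))) \<partial>\<pi>)
      \<le> (\<integral>\<^sup>+ p. ennreal C + ennreal L * (case p of (z', z) \<Rightarrow> d z' z) \<partial>\<pi>)"
    by (rule nn_integral_mono_AE)
  also have "\<dots> = ennreal C + ennreal L * (\<integral>\<^sup>+ p. (case p of (z', z) \<Rightarrow> d z' z) \<partial>\<pi>)"
    by (simp add: nn_integral_add nn_integral_cmult emeasure_space_1)
  also have "\<dots> < \<infinity>"
    using fin by (simp add: ennreal_mult_less_top)
  finally have "integrable \<pi> (\<lambda>p. f (fst p))"
    by (intro integrableI_bounded) auto
  then show ?thesis
    unfolding P_eq by (subst integrable_distr_eq) auto
qed

end

theory Submission
  imports Defs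
begin

text \<open>
  Both suprema are instances of one formula: for a finitely supported \<open>Q\<close> the supremum over its
  Wasserstein ball is \<open>E\<^sub>Q[f] + L \<delta>\<close>. Integrating the Lipschitz bound against a nearly optimal
  coupling gives \<open>\<le>\<close>. For \<open>\<ge>\<close>, let \<open>\<zeta> i\<close> be a point of near-maximal slope at \<open>Z i\<close>, at distance
  \<open>c i \<ge> \<delta>\<close>, and move the fraction \<open>\<delta> / c i\<close> of the mass at \<open>Z i\<close> to \<open>\<zeta> i\<close>: the transport costs
  exactly \<open>\<delta>\<close> and the expectation grows by at least \<open>(L - \<epsilon>) \<delta>\<close>.
\<close>

section \<open>Finitely supported measures as pushforwards of weighted index sets\<close>

lemma measurable_point_measure_finite:
  assumes "finite I" "Z \<in> I \<rightarrow> space M"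
  shows "Z \<in> measurable (point_measure I w) M"
  using assms by (auto simp: measurable_def space_point_measure sets_point_measure)

text \<open>Working on indices rather than points lets atoms coincide: \<open>Z\<close> need not be
  injective, and weights of indices with the same image add up.\<close>

lemma emeasure_distr_point_measure:
  assumes "finite I" "Z \<in> I \<rightarrow> space M" "A \<in> sets M"
  shows "emeasure (distr (point_measure I w) M Z) A = (\<Sum>i\<in>I. w i * indicator A (Z i))"
proof -
  have "emeasure (distr (point_measure I w) M Z) A
      = (\<integral>\<^sup>+ z. indicator A z \<partial>distr (point_measure I w) M Z)"
    using assms(3) by simp
  also have "\<dots> = (\<integral>\<^sup>+ i. indicator A (Z i) \<partial>point_measure I w)"
    using assms by (intro nn_integral_distr measurable_point_measure_finite) auto
  also have "\<dots> = (\<Sum>i\<in>I. w i * indicator A (Z i))"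
    using assms(1) by (rule nn_integral_point_measure_finite)
  finally show ?thesis .
qed

lemma distr_point_measure_in_prob_algebra:
  assumes "finite I" "Z \<in> I \<rightarrow> space M" "(\<Sum>i\<in>I. w i) = 1"
  shows "distr (point_measure I w) M Z \<in> space (prob_algebra M)"
proof -
  have "emeasure (distr (point_measure I w) M Z) (space M) = (\<Sum>i\<in>I. w i)"
    unfolding emeasure_distr_point_measure[OF assms(1,2) sets.top]
    by (rule sum.cong) (use assms(2) in \<open>auto simp: Pi_iff\<close>)
  then show ?thesis
    using assms(3) by (auto simp: space_prob_algebra intro!: prob_spaceI)
qed

lemma
  fixes f :: "'z \<Rightarrow> real"
  assumes "finite I" "Z \<in> I \<rightarrow> space M" "\<And>i. i \<in> I \<Longrightarrow> 0 \<le> \<mu> i"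
    and "f \<in> borel_measurable M"
  shows integrable_distr_point_measure:
      "integrable (distr (point_measure I (\<lambda>i. ennreal (\<mu> i))) M Z) f"
    and integral_distr_point_measure:
      "(\<integral>z. f z \<partial>distr (point_measure I (\<lambda>i. ennreal (\<mu> i))) M Z) = (\<Sum>i\<in>I. \<mu> i * f (Z i))"
proof -
  have Z: "Z \<in> measurable (point_measure I (\<lambda>i. ennreal (\<mu> i))) M"
    using assms by (intro measurable_point_measure_finite)
  show "integrable (distr (point_measure I (\<lambda>i. ennreal (\<mu> i))) M Z) f"
    using assms by (simp add: integrable_distr_eq[OF Z] integrable_point_measure_finite)
  show "(\<integral>z. f z \<partial>distr (point_measure I (\<lambda>i. ennreal (\<mu> i))) M Z) = (\<Sum>i\<in>I. \<mu> i * f (Z i))"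
    using assms by (simp add: integral_distr[OF Z] lebesgue_integral_point_measure_finite)
qed

lemma empirical_eq_distr_point_measure:
  assumes "Z \<in> {1..N} \<rightarrow> space M"
  shows "empirical M N \<mu> Z = distr (point_measure {1..N} (\<lambda>i. ennreal (\<mu> i))) M Z"
proof (rule measure_eqI)
  fix A assume "A \<in> sets (empirical M N \<mu> Z)"
  then have A: "A \<in> sets M" by simp
  then show "emeasure (empirical M N \<mu> Z) A
      = emeasure (distr (point_measure {1..N} (\<lambda>i. ennreal (\<mu> i))) M Z) A"
    unfolding emeasure_empirical[OF A]
      emeasure_distr_point_measure[OF finite_atLeastAtMost assms A]
    by (simp only: emeasure_return)
qed simp

text \<open>Keeping the map \<open>Z\<close> and shrinking the index set to \<open>{i}\<close> lets
  hypotheses about the whole dataset restrict directly to one data point.\<close>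

lemma return_eq_distr_point_measure:
  assumes "Z i \<in> space M"
  shows "return M (Z i) = distr (point_measure {i} (\<lambda>_. 1)) M Z"
proof (rule measure_eqI)
  fix A assume "A \<in> sets (return M (Z i))"
  then show "emeasure (return M (Z i)) A = emeasure (distr (point_measure {i} (\<lambda>_. 1)) M Z) A"
    using assms by (subst emeasure_distr_point_measure) auto
qed simp

section \<open>Upper bound: the Lipschitz inequality integrated against a coupling\<close>

lemma integral_wasserstein_ball_le:
  assumes d: "cost_function M d" and f: "f \<in> borel_measurable M"
    and S: "S \<in> sets M" and lip: "weak_lipschitz_at M d L S f"
    and supp: "AE z in Q. z \<in> S" and P: "P \<in> wasserstein_ball M d Q \<delta>"
    and \<delta>: "0 \<le> \<delta>" and int_P: "integrable P f" and int_Q: "integrable Q f"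
  shows "(\<integral>z. f z \<partial>P) \<le> (\<integral>z. f z \<partial>Q) + L * \<delta>"
proof -
  have L: "0 \<le> L" using lip by (simp add: weak_lipschitz_at_def)
  \<comment> \<open>The infimum over couplings need not be attained, so a slack \<open>e\<close> is
    allowed in order to pick an actual coupling.\<close>
  have le: "(\<integral>z. f z \<partial>P) - (\<integral>z. f z \<partial>Q) \<le> L * (\<delta> + e)" if e: "0 < e" for e
  proof -
    have "wasserstein M d P Q \<le> ennreal \<delta>"
      using P by (simp add: wasserstein_ball_def)
    also have "\<dots> < ennreal (\<delta> + e)" using \<delta> e by (intro ennreal_lessI) auto
    finally obtain \<pi> where \<pi>: "\<pi> \<in> couplings M P Q"
      and fin: "(\<integral>\<^sup>+ (z', z). d z' z \<partial>\<pi>) < ennreal (\<delta> + e)"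
      unfolding wasserstein_def by (auto simp: INF_less_iff)
    from \<pi> have sets_\<pi>: "sets \<pi> = sets (M \<Otimes>\<^sub>M M)"
      and P_eq: "P = distr \<pi> M fst" and Q_eq: "Q = distr \<pi> M snd"
      by (auto simp: couplings_def space_prob_algebra)
    note [measurable_cong] = sets_\<pi>
    note [measurable] = f S
    have [measurable]: "(\<lambda>(z', z). d z' z) \<in> borel_measurable \<pi>"
      using d sets_\<pi> by (simp add: cost_function_def cong: measurable_cong_sets)
    have fst_snd: "fst \<in> measurable \<pi> M" "snd \<in> measurable \<pi> M"
      by measurable
    have int: "integrable \<pi> (\<lambda>p. f (fst p))" "integrable \<pi> (\<lambda>p. f (snd p))"
      using int_P int_Q unfolding P_eq Q_eq
      by (simp_all only: integrable_distr_eq[OF fst_snd(1) f] integrable_distr_eq[OF fst_snd(2) f])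
    \<comment> \<open>The Lipschitz inequality is anchored at points of \<open>S\<close> only. It
      still applies almost everywhere, because the anchor is the second coordinate, whose law
      \<open>Q\<close> is concentrated on \<open>S\<close>.\<close>
    have "AE p in \<pi>. snd p \<in> S"
      using supp unfolding Q_eq by (subst (asm) AE_distr_iff) auto
    with AE_space have bound: "AE p in \<pi>. ennreal (norm (f (fst p) - f (snd p)))
        \<le> ennreal L * (case p of (z', z) \<Rightarrow> d z' z)"
    proof eventually_elim
      case (elim p)
      have "fst p \<in> space M"
        using elim(1) unfolding sets_eq_imp_space_eq[OF sets_\<pi>] space_pair_measure mem_Times_iff
        by (rule conjunct1)
      then show ?case
        using lip elim(2) unfolding weak_lipschitz_at_def by (simp add: case_prod_beta)
    qed
    have "(\<integral>z. f z \<partial>P) - (\<integral>z. f z \<partial>Q) = (\<integral>p. f (fst p) - f (snd p) \<partial>\<pi>)"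
      unfolding P_eq Q_eq integral_distr[OF fst_snd(1) f] integral_distr[OF fst_snd(2) f]
      using int by (rule Bochner_Integration.integral_diff[symmetric])
    then have "ennreal ((\<integral>z. f z \<partial>P) - (\<integral>z. f z \<partial>Q)) \<le> ennreal (norm (\<integral>p. f (fst p) - f (snd p) \<partial>\<pi>))"
      by (intro ennreal_leI) simp
    also have "\<dots> \<le> (\<integral>\<^sup>+ p. ennreal (norm (f (fst p) - f (snd p))) \<partial>\<pi>)"
      using int by (intro integral_norm_bound_ennreal Bochner_Integration.integrable_diff)
    also have "\<dots> \<le> (\<integral>\<^sup>+ p. ennreal L * (case p of (z', z) \<Rightarrow> d z' z) \<partial>\<pi>)"
      using bound by (rule nn_integral_mono_AE)
    also have "\<dots> = ennreal L * (\<integral>\<^sup>+ p. (case p of (z', z) \<Rightarrow> d z' z) \<partial>\<pi>)"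
      by (rule nn_integral_cmult) measurable
    also have "\<dots> \<le> ennreal L * ennreal (\<delta> + e)"
      using fin by (intro mult_left_mono) auto
    also have "\<dots> = ennreal (L * (\<delta> + e))"
      using L \<delta> e by (simp add: ennreal_mult)
    \<comment> \<open>Although \<open>ennreal\<close> sends negative reals to 0, the inequality
      returns to the reals, since its right-hand side is nonnegative.\<close>
    finally show ?thesis
      using L \<delta> e by (subst (asm) ennreal_le_iff) auto
  qed
  have "(\<integral>z. f z \<partial>P) - (\<integral>z. f z \<partial>Q) - L * \<delta> \<le> 0"
  proof (rule tendsto_lowerbound)
    show "((\<lambda>e. L * e) \<longlongrightarrow> 0) (at_right 0)" by (auto intro!: tendsto_eq_intros)
    show "\<forall>\<^sub>F e in at_right 0. (\<integral>z. f z \<partial>P) - (\<integral>z. f z \<partial>Q) - L * \<delta> \<le> L * e"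
      using eventually_at_right_less[of "0::real"]
    proof eventually_elim
      case (elim e)
      then show ?case using le[of e] by (simp add: distrib_left)
    qed
  qed simp
  then show ?thesis by simp
qed

section \<open>Lower bound: moving a fraction of each atom\<close>

text \<open>The fraction \<open>t i\<close> of atom \<open>i\<close> travels to
  \<open>\<zeta> i\<close> and the rest stays put for free. Each atom costs at most \<delta> per
  unit of its mass, so the total cost is at most \<delta> because the masses sum to 1.\<close>

lemma wasserstein_ball_partial_transport:
  fixes M :: "'z measure" and I :: "'i set" and Z :: "'i \<Rightarrow> 'z"
    and \<mu> t :: "'i \<Rightarrow> real" and f :: "'z \<Rightarrow> real"
  defines "Q \<equiv> distr (point_measure I (\<lambda>i. ennreal (\<mu> i))) M Z"
  assumes I: "finite I" and Z: "Z \<in> I \<rightarrow> space M"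
    and \<mu>: "\<And>i. i \<in> I \<Longrightarrow> 0 \<le> \<mu> i" "(\<Sum>i\<in>I. \<mu> i) = 1"
    and d: "cost_function M d" and f: "f \<in> borel_measurable M"
    and \<zeta>: "\<And>i. i \<in> I \<Longrightarrow> \<zeta> i \<in> space M"
    and t: "\<And>i. i \<in> I \<Longrightarrow> 0 \<le> t i" "\<And>i. i \<in> I \<Longrightarrow> t i \<le> 1"
    and cost: "\<And>i. i \<in> I \<Longrightarrow> ennreal (t i) * d (\<zeta> i) (Z i) \<le> ennreal \<delta>"
  shows "\<exists>P\<in>wasserstein_ball M d Q \<delta>.
    (\<integral>z. f z \<partial>P) = (\<Sum>i\<in>I. \<mu> i * (f (Z i) + t i * (f (\<zeta> i) - f (Z i))))"
proof -
  \<comment> \<open>Each atom is split in two by a flag: \<open>True\<close> marks the moved part,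
    \<open>False\<close> the part that stays. \<open>w\<close> is the mass of a part,
    \<open>X\<close> its destination and \<open>Y\<close> the pair of destination and origin, in the
    argument order of \<open>d\<close>; the law of \<open>Y\<close> is the coupling.\<close>
  define J where "J = I \<times> (UNIV :: bool set)"
  define w where "w = (\<lambda>(i, b). \<mu> i * (if b then t i else 1 - t i))"
  define X where "X = (\<lambda>(i, b). if b then \<zeta> i else Z i)"
  define Y where "Y = (\<lambda>j. (X j, Z (fst j)))"
  define \<pi> where "\<pi> = distr (point_measure J (\<lambda>j. ennreal (w j))) (M \<Otimes>\<^sub>M M) Y"
  define P where "P = distr (point_measure J (\<lambda>j. ennreal (w j))) M X"
  have J: "finite J" using I by (simp add: J_def)
  have w: "0 \<le> w j" if "j \<in> J" for j
    using that \<mu>(1) t by (auto simp: J_def w_def)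
  have sum_J: "(\<Sum>j\<in>J. g j) = (\<Sum>i\<in>I. g (i, True) + g (i, False))"
    for g :: "'i \<times> bool \<Rightarrow> 'c :: comm_monoid_add"
    unfolding J_def sum.cartesian_product[symmetric, of "\<lambda>i b. g (i, b)", simplified]
    by (simp add: UNIV_bool add.commute)
  have X: "X \<in> J \<rightarrow> space M"
    using Z \<zeta> by (auto simp: J_def X_def)
  have Zf: "(\<lambda>j. Z (fst j)) \<in> J \<rightarrow> space M"
    using Z by (auto simp: J_def)
  have Y: "Y \<in> J \<rightarrow> space (M \<Otimes>\<^sub>M M)"
    using X Zf by (auto simp: Y_def space_pair_measure)
  have Y_meas: "Y \<in> measurable (point_measure J (\<lambda>j. ennreal (w j))) (M \<Otimes>\<^sub>M M)"
    by (intro measurable_point_measure_finite J Y)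
  have "(\<Sum>j\<in>J. w j) = 1"
    unfolding sum_J using \<mu>(2) by (simp add: w_def algebra_simps)
  then have w_sum: "(\<Sum>j\<in>J. ennreal (w j)) = 1"
    using w by simp
  \<comment> \<open>The two parts of an atom recombine to its full mass; this is what makes the
    second marginal equal to \<open>Q\<close>.\<close>
  have \<mu>_split: "ennreal (\<mu> i) = ennreal (w (i, True)) + ennreal (w (i, False))" if "i \<in> I" for i
    using that \<mu>(1) w[of "(i, True)"] w[of "(i, False)"]
    by (subst ennreal_plus[symmetric]) (simp_all add: J_def w_def algebra_simps)
  have "distr \<pi> M snd = distr (point_measure J (\<lambda>j. ennreal (w j))) M (\<lambda>j. Z (fst j))"
    unfolding \<pi>_def by (subst distr_distr[OF _ Y_meas]) (simp_all add: o_def Y_def)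
  also have "\<dots> = Q"
  proof (rule measure_eqI)
    fix A assume "A \<in> sets (distr (point_measure J (\<lambda>j. ennreal (w j))) M (\<lambda>j. Z (fst j)))"
    then have A: "A \<in> sets M" by simp
    show "emeasure (distr (point_measure J (\<lambda>j. ennreal (w j))) M (\<lambda>j. Z (fst j))) A
        = emeasure (Q) A"
      unfolding Q_def emeasure_distr_point_measure[OF I Z A]
        emeasure_distr_point_measure[OF J Zf A] sum_J
      by (simp add: \<mu>_split distrib_right)
  qed (simp add: Q_def)
  finally have snd_\<pi>: "distr \<pi> M snd = Q" .
  have fst_\<pi>: "distr \<pi> M fst = P"
    unfolding \<pi>_def P_def by (subst distr_distr[OF _ Y_meas]) (simp_all add: o_def Y_def)
  have "\<pi> \<in> couplings M P (Q)"
    using distr_point_measure_in_prob_algebra[OF J Y w_sum] fst_\<pi> snd_\<pi>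
    by (simp add: couplings_def \<pi>_def)
  then have "wasserstein M d P (Q) \<le> (\<integral>\<^sup>+ (z', z). d z' z \<partial>\<pi>)"
    unfolding wasserstein_def by (rule INF_lower)
  also have "\<dots> = (\<integral>\<^sup>+ j. (case Y j of (z', z) \<Rightarrow> d z' z) \<partial>point_measure J (\<lambda>j. ennreal (w j)))"
    unfolding \<pi>_def using d by (intro nn_integral_distr Y_meas) (simp add: cost_function_def)
  also have "\<dots> = (\<Sum>j\<in>J. ennreal (w j) * d (X j) (Z (fst j)))"
    using J by (simp add: nn_integral_point_measure_finite Y_def)
  \<comment> \<open>The \<open>False\<close> terms vanish because
    \<open>d (Z i) (Z i) = 0\<close>.\<close>
  also have "\<dots> = (\<Sum>i\<in>I. ennreal (\<mu> i) * (ennreal (t i) * d (\<zeta> i) (Z i)))"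
    unfolding sum_J using Z d \<mu>(1) t
    by (intro sum.cong) (simp_all add: w_def X_def Pi_iff cost_function_def ennreal_mult mult.assoc)
  also have "\<dots> \<le> (\<Sum>i\<in>I. ennreal (\<mu> i) * ennreal \<delta>)"
    using cost by (intro sum_mono mult_left_mono) auto
  also have "\<dots> = ennreal \<delta>"
    using \<mu> by (simp add: sum_distrib_right[symmetric])
  finally have "P \<in> wasserstein_ball M d Q \<delta>"
    using distr_point_measure_in_prob_algebra[OF J X w_sum]
    by (simp add: wasserstein_ball_def P_def)
  moreover have "(\<integral>z. f z \<partial>P) = (\<Sum>i\<in>I. \<mu> i * (f (Z i) + t i * (f (\<zeta> i) - f (Z i))))"
    unfolding P_def
    by (subst integral_distr_point_measure[OF J X w f])
      (simp_all add: sum_J w_def X_def algebra_simps)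
  ultimately show ?thesis by blast
qed

section \<open>The supremum over a ball with finitely supported centre\<close>

text \<open>The index set is arbitrary so that one formula serves both the whole dataset and a
  single data point. Taking the supremum in \<open>ereal\<close> makes it meaningful before
  boundedness is known.\<close>

lemma SUP_wasserstein_ball_discrete:
  fixes M :: "'z measure" and I :: "'i set" and Z :: "'i \<Rightarrow> 'z"
    and \<mu> :: "'i \<Rightarrow> real" and f :: "'z \<Rightarrow> real"
  defines "Q \<equiv> distr (point_measure I (\<lambda>i. ennreal (\<mu> i))) M Z"
  assumes singletons: "\<And>z. z \<in> space M \<Longrightarrow> {z} \<in> sets M"
    and I: "finite I" and Z: "Z \<in> I \<rightarrow> space M"
    and \<mu>: "\<And>i. i \<in> I \<Longrightarrow> 0 \<le> \<mu> i" "(\<Sum>i\<in>I. \<mu> i) = 1"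
    and d: "cost_function M d" and f: "f \<in> borel_measurable M"
    and \<delta>: "0 < \<delta>" and L: "0 < L"
    and lip: "weak_lipschitz_at M d L (Z ` I) f"
    and slope: "\<And>\<epsilon> i. 0 < \<epsilon> \<Longrightarrow> \<epsilon> < L \<Longrightarrow> i \<in> I \<Longrightarrow>
      \<exists>z\<in>space M. ennreal \<delta> \<le> d z (Z i) \<and> d z (Z i) < \<infinity> \<and>
        f z - f (Z i) \<ge> (L - \<epsilon>) * enn2real (d z (Z i))"
  shows "(SUP P\<in>wasserstein_ball M d Q \<delta>. ereal (\<integral>z. f z \<partial>P))
    = ereal ((\<Sum>i\<in>I. \<mu> i * f (Z i)) + L * \<delta>)"
proof (rule antisym)
  have "finite (Z ` I)" using I by simp
  \<comment> \<open>Measurability of singletons makes the finite support measurable, as the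
    almost-everywhere statements about it require.\<close>
  moreover have "Z ` I \<in> sets M"
  proof (rule sets.countable)
    show "countable (Z ` I)" using I by (intro countable_finite) simp
    show "{z} \<in> sets M" if "z \<in> Z ` I" for z
      using that Z by (intro singletons) auto
  qed
  ultimately have S: "finite (Z ` I)" "Z ` I \<in> sets M" .
  have "Z \<in> measurable (point_measure I (\<lambda>i. ennreal (\<mu> i))) M"
    by (intro measurable_point_measure_finite I Z)
  then have supp: "AE z in Q. z \<in> Z ` I"
    unfolding Q_def using S(2) by (subst AE_distr_iff) (auto simp: AE_point_measure)
  have Q_f: "integrable Q f" "(\<integral>z. f z \<partial>Q) = (\<Sum>i\<in>I. \<mu> i * f (Z i))"
    unfolding Q_def
    by (rule integrable_distr_point_measure[OF I Z \<mu>(1) f],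
        assumption, rule integral_distr_point_measure[OF I Z \<mu>(1) f])
  show "(SUP P\<in>wasserstein_ball M d Q \<delta>. ereal (\<integral>z. f z \<partial>P))
      \<le> ereal ((\<Sum>i\<in>I. \<mu> i * f (Z i)) + L * \<delta>)"
  proof (rule SUP_least)
    fix P assume P: "P \<in> wasserstein_ball M d Q \<delta>"
    show "ereal (\<integral>z. f z \<partial>P) \<le> ereal ((\<Sum>i\<in>I. \<mu> i * f (Z i)) + L * \<delta>)"
      using integral_wasserstein_ball_le[OF d f S(2) lip supp P less_imp_le[OF \<delta>]
          integrable_wasserstein_ball[OF d f S lip supp P] Q_f(1)]
      by (simp add: Q_f(2))
  qed
  have lower: "ereal ((\<Sum>i\<in>I. \<mu> i * f (Z i)) + (L - \<epsilon>) * \<delta>)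
      \<le> (SUP P\<in>wasserstein_ball M d Q \<delta>. ereal (\<integral>z. f z \<partial>P))"
    if \<epsilon>: "0 < \<epsilon>" "\<epsilon> < L" for \<epsilon>
  proof -
    obtain \<zeta> where \<zeta>: "\<And>i. i \<in> I \<Longrightarrow> \<zeta> i \<in> space M"
      and d_ge: "\<And>i. i \<in> I \<Longrightarrow> ennreal \<delta> \<le> d (\<zeta> i) (Z i)"
      and d_fin: "\<And>i. i \<in> I \<Longrightarrow> d (\<zeta> i) (Z i) < \<infinity>"
      and f_ge: "\<And>i. i \<in> I \<Longrightarrow> (L - \<epsilon>) * enn2real (d (\<zeta> i) (Z i)) \<le> f (\<zeta> i) - f (Z i)"
      using slope[OF \<epsilon>] by metis
    \<comment> \<open>The distance is finite here, so \<open>enn2real\<close> loses nothing; its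
      value 0 at infinity does not arise.\<close>
    define c where "c i = enn2real (d (\<zeta> i) (Z i))" for i
    have d_eq: "d (\<zeta> i) (Z i) = ennreal (c i)" if "i \<in> I" for i
      using d_fin[OF that] by (simp add: c_def)
    have c: "\<delta> \<le> c i" if "i \<in> I" for i
      using d_ge[OF that] \<delta> unfolding d_eq[OF that]
      by (simp add: ennreal_le_iff2)
    \<comment> \<open>This fraction spends the budget \<delta> exactly. The bound
      \<open>\<delta> \<le> c i\<close> keeps it at most 1 and, with \<delta> positive, rules out
      division by zero.\<close>
    define t where "t i = \<delta> / c i" for i
    have t: "0 \<le> t i" "t i \<le> 1" "t i * c i = \<delta>" if "i \<in> I" for i
      using c[OF that] \<delta> by (auto simp: t_def field_simps)
    have cost: "ennreal (t i) * d (\<zeta> i) (Z i) \<le> ennreal \<delta>" if "i \<in> I" for i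
      using t[OF that] c[OF that] \<delta> by (simp add: d_eq[OF that] ennreal_mult[symmetric])
    obtain P where P: "P \<in> wasserstein_ball M d Q \<delta>"
      and P_f: "(\<integral>z. f z \<partial>P) = (\<Sum>i\<in>I. \<mu> i * (f (Z i) + t i * (f (\<zeta> i) - f (Z i))))"
      using wasserstein_ball_partial_transport[where \<zeta>=\<zeta> and t=t, OF I Z \<mu> d f \<zeta> t(1,2) cost,
          folded Q_def] by blast
    \<comment> \<open>The distance \<open>c i\<close> cancels against \<open>t i\<close>, so the
      guaranteed gain is the same for every atom and survives averaging unchanged.\<close>
    have "(L - \<epsilon>) * \<delta> \<le> t i * (f (\<zeta> i) - f (Z i))" if "i \<in> I" for i
    proof -
      have "(L - \<epsilon>) * \<delta> = t i * ((L - \<epsilon>) * c i)"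
        using t(3)[OF that] by (metis mult.left_commute)
      also have "\<dots> \<le> t i * (f (\<zeta> i) - f (Z i))"
        using f_ge[OF that] t(1)[OF that] by (intro mult_left_mono) (simp_all add: c_def)
      finally show ?thesis .
    qed
    then have "(\<Sum>i\<in>I. \<mu> i * (f (Z i) + (L - \<epsilon>) * \<delta>)) \<le> (\<integral>z. f z \<partial>P)"
      unfolding P_f using \<mu>(1) by (intro sum_mono mult_left_mono add_left_mono)
    then have "(\<Sum>i\<in>I. \<mu> i * f (Z i)) + (L - \<epsilon>) * \<delta> \<le> (\<integral>z. f z \<partial>P)"
      using \<mu>(2) by (simp add: distrib_left sum.distrib sum_distrib_right[symmetric])
    then show ?thesis using P by (intro SUP_upper2) auto
  qed
  show "ereal ((\<Sum>i\<in>I. \<mu> i * f (Z i)) + L * \<delta>)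
      \<le> (SUP P\<in>wasserstein_ball M d Q \<delta>. ereal (\<integral>z. f z \<partial>P))"
  \<comment> \<open>The lower bound holds for \<epsilon> between 0 and \<open>L\<close>, which is a
    right neighbourhood of 0 because \<open>L\<close> is positive; \<epsilon> may therefore tend to
    0.\<close>
  proof (rule tendsto_upperbound)
    show "((\<lambda>\<epsilon>. ereal ((\<Sum>i\<in>I. \<mu> i * f (Z i)) + (L - \<epsilon>) * \<delta>))
        \<longlongrightarrow> ereal ((\<Sum>i\<in>I. \<mu> i * f (Z i)) + L * \<delta>)) (at_right 0)"
      by (auto intro!: tendsto_eq_intros)
    show "\<forall>\<^sub>F \<epsilon> in at_right 0. ereal ((\<Sum>i\<in>I. \<mu> i * f (Z i)) + (L - \<epsilon>) * \<delta>)
        \<le> (SUP P\<in>wasserstein_ball M d Q \<delta>. ereal (\<integral>z. f z \<partial>P))"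
      using eventually_at_right_real[OF L] by eventually_elim (use lower in auto)
  qed simp
qed

section \<open>Specialisation to the empirical distribution and to each data point\<close>

theorem theorem3p2:
  fixes M :: "'z measure"
    and N :: nat
    and Z :: "nat \<Rightarrow> 'z"
    and \<mu> :: "nat \<Rightarrow> real"
    and d :: "'z \<Rightarrow> 'z \<Rightarrow> ennreal"
    and \<delta> L :: real
    and B :: "'b set"
    and \<beta> :: 'b
    and loss :: "'z \<Rightarrow> 'b \<Rightarrow> real"
    and \<psi> :: "'b \<Rightarrow> 'z \<Rightarrow> real"
  assumes singletons: "\<And>z. z \<in> space M \<Longrightarrow> {z} \<in> sets M"
    and loss_measurable: "\<And>b. b \<in> B \<Longrightarrow> (\<lambda>z. loss z b) \<in> borel_measurable M"
    and data: "\<And>i. i \<in> {1..N} \<Longrightarrow> Z i \<in> space M"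
    and weights_nonneg: "\<And>i. i \<in> {1..N} \<Longrightarrow> 0 \<le> \<mu> i"
    and weights_sum: "(\<Sum>i=1..N. \<mu> i) = 1"
    and cost: "cost_function M d"
    and \<delta>: "0 < \<delta>"
    and loss_form: "\<And>z b. z \<in> space M \<Longrightarrow> b \<in> B \<Longrightarrow> loss z b = \<psi> b z"
    and \<beta>: "\<beta> \<in> B"
    and L: "0 < L"
    and A1: "weak_lipschitz_at M d L (Z ` {1..N}) (\<psi> \<beta>)"
    and A2: "\<And>\<epsilon> i. 0 < \<epsilon> \<Longrightarrow> \<epsilon> < L \<Longrightarrow> i \<in> {1..N} \<Longrightarrow>
      \<exists>z\<in>space M. ennreal \<delta> \<le> d z (Z i) \<and> d z (Z i) < \<infinity> \<and>
        \<psi> \<beta> z - \<psi> \<beta> (Z i) \<ge> (L - \<epsilon>) * enn2real (d z (Z i))"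
  shows "(\<Sum>i=1..N. ereal (\<mu> i) *
            (SUP P\<in>wasserstein_ball M d (return M (Z i)) \<delta>. ereal (\<integral>z. loss z \<beta> \<partial>P)))
          = (SUP P\<in>wasserstein_ball M d (empirical M N \<mu> Z) \<delta>. ereal (\<integral>z. loss z \<beta> \<partial>P))
       \<and> (SUP P\<in>wasserstein_ball M d (empirical M N \<mu> Z) \<delta>. ereal (\<integral>z. loss z \<beta> \<partial>P))
          = ereal ((\<integral>z. loss z \<beta> \<partial>(empirical M N \<mu> Z)) + L * \<delta>)"
proof -
  define f where "f = (\<lambda>z. loss z \<beta>)"
  have f: "f \<in> borel_measurable M"
    using loss_measurable[OF \<beta>] by (simp add: f_def)
  \<comment> \<open>Measurability is given for \<open>loss\<close>, while the Lipschitz and slope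
    conditions are given for \<psi>. The two agree on \<open>space M\<close>, which contains every
    point those conditions speak of.\<close>
  have f_eq: "\<psi> \<beta> z = f z" if "z \<in> space M" for z
    using loss_form[OF that \<beta>] by (simp add: f_def)
  have Z: "Z \<in> {1..N} \<rightarrow> space M"
    using data by simp
  have lip: "weak_lipschitz_at M d L (Z ` {1..N}) f"
    using A1 data unfolding weak_lipschitz_at_def by (auto simp: f_eq)
  have slope: "\<exists>z\<in>space M. ennreal \<delta> \<le> d z (Z i) \<and> d z (Z i) < \<infinity> \<and>
      f z - f (Z i) \<ge> (L - \<epsilon>) * enn2real (d z (Z i))" if "0 < \<epsilon>" "\<epsilon> < L" "i \<in> {1..N}" for \<epsilon> i
    using A2[OF that] data[OF that(3)] by (auto simp: f_eq)
  note empirical_eq = empirical_eq_distr_point_measure[OF Z, of \<mu>]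
  have integral_eq: "(\<integral>z. f z \<partial>empirical M N \<mu> Z) = (\<Sum>i=1..N. \<mu> i * f (Z i))"
    unfolding empirical_eq
    by (rule integral_distr_point_measure[OF finite_atLeastAtMost Z weights_nonneg f])
  have SUP_empirical: "(SUP P\<in>wasserstein_ball M d (empirical M N \<mu> Z) \<delta>. ereal (\<integral>z. f z \<partial>P))
      = ereal ((\<Sum>i=1..N. \<mu> i * f (Z i)) + L * \<delta>)"
    unfolding empirical_eq
    by (rule SUP_wasserstein_ball_discrete[OF singletons finite_atLeastAtMost Z weights_nonneg
          weights_sum cost f \<delta> L lip slope])
  have SUP_return: "(SUP P\<in>wasserstein_ball M d (return M (Z i)) \<delta>. ereal (\<integral>z. f z \<partial>P))
      = ereal (f (Z i) + L * \<delta>)" if i: "i \<in> {1..N}" for i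
  proof -
    have "weak_lipschitz_at M d L (Z ` {i}) f"
      using lip i by (auto simp: weak_lipschitz_at_def)
    then show ?thesis
      unfolding return_eq_distr_point_measure[of Z, OF data[OF i]]
      using SUP_wasserstein_ball_discrete[of M "{i}" Z "\<lambda>_. 1" d f \<delta> L]
        singletons data[OF i] cost f \<delta> L slope i by simp
  qed
  \<comment> \<open>Each local supremum is a real number exceeding \<open>f (Z i)\<close> by the
    same amount \<open>L * \<delta>\<close>. The weighted average therefore adds
    \<open>L * \<delta>\<close> once, and no zero weight meets an infinite supremum.\<close>
  have "(\<Sum>i=1..N. ereal (\<mu> i) *
      (SUP P\<in>wasserstein_ball M d (return M (Z i)) \<delta>. ereal (\<integral>z. f z \<partial>P)))
      = (\<Sum>i=1..N. ereal (\<mu> i * (f (Z i) + L * \<delta>)))"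
    by (intro sum.cong) (simp_all add: SUP_return)
  also have "\<dots> = ereal ((\<Sum>i=1..N. \<mu> i * f (Z i)) + L * \<delta>)"
    using weights_sum by (simp add: distrib_left sum.distrib sum_distrib_right[symmetric])
  finally show ?thesis
    using SUP_empirical integral_eq by (simp add: f_def)
qed

end
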